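(* Let $\gamma>1$, $k_1,k_2,k_3>-1$ and $k=\frac{(1+k_1)(1+k_3)}{(1+k_2)^2}-1$. Consider self-similar Riemann solutions with initial data $U_L$ ($x<0$), $U_R$ ($x>0$) of the one-dimensional Euler equations with singular source $\partial_tU+\partial_xF(U)=\delta(x)S$ (precise definition in the context), whose stationary wave at $x=0$ has left-hand state $U_-$ and right-hand state $U_+$ with $u_->0$, $u_+>0$, satisfying the jump relation and the Monotonicity Criterion. With the Types 1–7 of structures listed in the context: (i) If $k>0$, then all possible structures of the Riemann solutions are Type 1, Type 2, Type 3 and Type 4. (ii) If $k<0$, then all possible structures of the Riemann solutions are Type 1, Type 2, Type 5 and Type 6. (iii) If $k=0$, then all possible structures of the Riemann solutions are Type 1, Type 2 and Type 7.
   Context: Equations. $U=(\rho,\rho u,E)^T$, $F(U)=(\rho u,\rho u^2+p,(E+p)u)^T$, with $\rho>0$, $p>0$, polytropic ideal gas $E=\frac{p}{\gamma-1}+\frac12\rho u^2$, sound speed $a=\sqrt{\gamma p/\rho}$, Mach number $M=u/a$ (for $u>0$), eigenvalues of $\partial F/\partial U$: $\lambda_1=u-a$, $\lambda_2=u$, $\lambda_3=u+a$. $\delta$ is the Dirac delta at the origin. The source, when the velocities on both sides of $x=0$ are positive, is $S=\mathrm{diag}(k_1,k_2,k_3)F(U_-)$, where $U_-$ is the state on the left of the origin. Subscripts on $u,a,M,\dots$ refer to the corresponding state. Stationary wave. A discontinuity located on $x=0$ with left-hand state $U_-$ and right-hand state $U_+$ satisfying the jump relation $\rho_-u_-(1+k_1)=\rho_+u_+$,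 $(\rho_-u_-^2+p_-)(1+k_2)=\rho_+u_+^2+p_+$, $(E_-+p_-)u_-(1+k_3)=(E_++p_+)u_+$. Monotonicity Criterion: $\lambda_j(U_-)\lambda_j(U_+)\ge 0$ for $j=1,2,3$. The stationary wave (and the Riemann solution containing it) is called choked if $\lambda_j(U_-)\lambda_j(U_+)=0$ for some $j\in\{1,2,3\}$. Riemann solution (double classical Riemann problem form). A self-similar solution $U(x,t)=U(x/t)$ consisting of constant states separated by: a stationary wave at $x=0$ with states $U_-,U_+$; in the left half-plane, from $U_L$ to $U_-$ in order from left to right, a 1-wave, a 2-contact discontinuity and a 3-wave of the classical Euler equations $\partial_tU+\partial_xF(U)=0$, all travelling with nonpositive speeds; in the right half-plane, from $U_+$ to $U_R$ in order from left to right, a 1-wave, a 2-contact discontinuity and a 3-wave of the classical Euler equations, all travelling with nonnegative speeds. Any of the six classical waves may be absent (trivial). A 1-wave or 3-wave is either a Lax shock ($j$-shock of speed $\sigma$ from left state $V$ to right state $W$: $F(W)-F(V)=\sigma(W-V)$ and $\lambda_j(V)>\sigma>\lambda_j(W)$) or a centred rarefaction wave of the $j$-th family (whose speeds range over $[\lambda_j(V),\lambda_j(W)]$). A 2-contact discontinuity has equal $u$ and $p$ on both sides and speed $u$. Notation for structures. Waves are listed from left to right, joined by $\oplus$. $\mathcal{D}(V,W)$: $V$ and $W$ are joined by the stationary wave. $\mathcal{C}(V,W)$: joined by a 2-contact discontinuity. $\mathcal{R}(V,W)$: joined by a rarefaction wave; $\mathcal{W}(V,W)$: joined by a shock or a rarefaction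 wave. A $\mathcal{W}$ or $\mathcal{R}$ starting at $U_L$ or at $U_+$ is a 1-wave; $\mathcal{W}(U_4,U_R)$ is a 3-wave. Each of $\mathcal{W},\mathcal{R},\mathcal{C}$ may be trivial (equal states). $U_3,U_4$ are intermediate constant states; $\mathcal{D}(U_L,U_+)$ at the start means $U_-=U_L$ (no wave in the left half-plane). Types. Types 1 and 2 are non-choked, Types 3–7 are choked. Type 1: $\mathcal{W}(U_L,U_-)\oplus\mathcal{D}(U_-,U_+)\oplus\mathcal{C}(U_+,U_4)\oplus\mathcal{W}(U_4,U_R)$. Type 2: $\mathcal{D}(U_L,U_+)\oplus\mathcal{W}(U_+,U_3)\oplus\mathcal{C}(U_3,U_4)\oplus\mathcal{W}(U_4,U_R)$. Type 3: $\mathcal{W}(U_L,U_-)\oplus\mathcal{D}(U_-,U_+)\oplus\mathcal{R}(U_+,U_3)\oplus\mathcal{C}(U_3,U_4)\oplus\mathcal{W}(U_4,U_R)$ with $M_+=1$. Type 4: $\mathcal{D}(U_L,U_+)\oplus\mathcal{R}(U_+,U_3)\oplus\mathcal{C}(U_3,U_4)\oplus\mathcal{W}(U_4,U_R)$ with $M_+=1$. Type 5: $\mathcal{R}(U_L,U_-)\oplus\mathcal{D}(U_-,U_+)\oplus\mathcal{W}(U_+,U_3)\oplus\mathcal{C}(U_3,U_4)\oplus\mathcal{W}(U_4,U_R)$ with $M_-=1$. Type 6: $\mathcal{R}(U_L,U_-)\oplus\mathcal{D}(U_-,U_+)\oplus\mathcal{C}(U_+,U_4)\oplus\mathcal{W}(U_4,U_R)$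 with $M_-=1$. Type 7: $\mathcal{R}(U_L,U_-)\oplus\mathcal{D}(U_-,U_+)\oplus\mathcal{R}(U_+,U_3)\oplus\mathcal{C}(U_3,U_4)\oplus\mathcal{W}(U_4,U_R)$ with $M_-=M_+=1$. "All possible structures are ..." means that every such Riemann solution has one of the listed structures. *)

theory Defs
  imports "HOL-Analysis.Analysis"
begin

text \<open>A state is the vector \<open>(\<rho>, \<rho> u, E)\<close> of conserved quantities.\<close>

type_synonym state = "real ^ 3"

definition density :: "state \<Rightarrow> real" where
  "density U = U $ 1"

definition velocity :: "state \<Rightarrow> real" where
  "velocity U = U $ 2 / U $ 1"

definition energy :: "state \<Rightarrow> real" where
  "energy U = U $ 3"

text \<open>The equation of state \<open>E = p / (\<gamma> - 1) + \<rho> u\<^sup>2 / 2\<close>, solved for \<open>p\<close>.\<close>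

definition pressure :: "real \<Rightarrow> state \<Rightarrow> real" where
  "pressure \<gamma> U = (\<gamma> - 1) * (energy U - density U * (velocity U)\<^sup>2 / 2)"

definition gas_state :: "real \<Rightarrow> state \<Rightarrow> bool" where
  "gas_state \<gamma> U \<longleftrightarrow> density U > 0 \<and> pressure \<gamma> U > 0"

definition sound_speed :: "real \<Rightarrow> state \<Rightarrow> real" where
  "sound_speed \<gamma> U = sqrt (\<gamma> * pressure \<gamma> U / density U)"

definition mach :: "real \<Rightarrow> state \<Rightarrow> real" where
  "mach \<gamma> U = velocity U / sound_speed \<gamma> U"

definition flux :: "real \<Rightarrow> state \<Rightarrow> state" where
  "flux \<gamma> U = vector
    [density U * velocity U,
     density U * (velocity U)\<^sup>2 + pressure \<gamma> U,
     (energy U + pressure \<gamma> U) * velocity U]"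

text \<open>Meaningful only for \<open>j \<in> {1, 2, 3}\<close>.\<close>

definition eigval :: "real \<Rightarrow> nat \<Rightarrow> state \<Rightarrow> real" where
  "eigval \<gamma> j U =
    (if j = 1 then velocity U - sound_speed \<gamma> U
     else if j = 2 then velocity U
     else velocity U + sound_speed \<gamma> U)"

definition stationary_wave :: "real \<Rightarrow> real \<Rightarrow> real \<Rightarrow> real \<Rightarrow> state \<Rightarrow> state \<Rightarrow> bool" where
  "stationary_wave \<gamma> k1 k2 k3 V W \<longleftrightarrow>
    density V * velocity V * (1 + k1) = density W * velocity W \<and>
    (density V * (velocity V)\<^sup>2 + pressure \<gamma> V) * (1 + k2)
      = density W * (velocity W)\<^sup>2 + pressure \<gamma> W \<and>
    (energy V + pressure \<gamma> V) * velocity V * (1 + k3)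
      = (energy W + pressure \<gamma> W) * velocity W"

definition monotonicity_criterion :: "real \<Rightarrow> state \<Rightarrow> state \<Rightarrow> bool" where
  "monotonicity_criterion \<gamma> V W \<longleftrightarrow> (\<forall>j\<in>{1, 2, 3}. eigval \<gamma> j V * eigval \<gamma> j W \<ge> 0)"

definition choked :: "real \<Rightarrow> state \<Rightarrow> state \<Rightarrow> bool" where
  "choked \<gamma> V W \<longleftrightarrow> (\<exists>j\<in>{1, 2, 3}. eigval \<gamma> j V * eigval \<gamma> j W = 0)"

definition lax_shock :: "real \<Rightarrow> nat \<Rightarrow> real \<Rightarrow> state \<Rightarrow> state \<Rightarrow> bool" where
  "lax_shock \<gamma> j \<sigma> V W \<longleftrightarrow>
    flux \<gamma> W - flux \<gamma> V = \<sigma> *\<^sub>R (W - V) \<and> eigval \<gamma> j V > \<sigma> \<and> \<sigma> > eigval \<gamma> j W"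

text \<open>
  A nontrivial centred rarefaction of the \<open>j\<close>-th family is a smooth self-similar solution
  \<open>\<Phi> (x / t)\<close> of \<open>\<partial>\<^sub>t U + \<partial>\<^sub>x F(U) = 0\<close>, that is \<open>(F \<circ> \<Phi>)' \<xi> = \<xi> \<Phi>' \<xi>\<close>, along which the
  \<open>j\<close>-th eigenvalue equals \<open>\<xi>\<close>. The last clause says that \<open>U\<close> is this fan inside the wave.
\<close>

definition rarefaction :: "real \<Rightarrow> (real \<Rightarrow> state) \<Rightarrow> nat \<Rightarrow> state \<Rightarrow> state \<Rightarrow> bool" where
  "rarefaction \<gamma> U j V W \<longleftrightarrow>
    eigval \<gamma> j V < eigval \<gamma> j W \<and>
    (\<exists>\<Phi>. \<Phi> (eigval \<gamma> j V) = V \<and> \<Phi> (eigval \<gamma> j W) = W \<and>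
      (\<forall>\<xi>\<in>{eigval \<gamma> j V..eigval \<gamma> j W}.
        gas_state \<gamma> (\<Phi> \<xi>) \<and> eigval \<gamma> j (\<Phi> \<xi>) = \<xi> \<and>
        (\<exists>D. (\<Phi> has_vector_derivative D) (at \<xi> within {eigval \<gamma> j V..eigval \<gamma> j W}) \<and>
          ((\<lambda>\<eta>. flux \<gamma> (\<Phi> \<eta>)) has_vector_derivative \<xi> *\<^sub>R D)
            (at \<xi> within {eigval \<gamma> j V..eigval \<gamma> j W}))) \<and>
      (\<forall>\<xi>\<in>{eigval \<gamma> j V<..<eigval \<gamma> j W}. U \<xi> = \<Phi> \<xi>))"

text \<open>
  In the following predicates \<open>S\<close> is the set of speeds occupied by the wave; a trivial (absent)
  wave has equal states and occupies no speed at all.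
\<close>

definition R_wave :: "real \<Rightarrow> (real \<Rightarrow> state) \<Rightarrow> nat \<Rightarrow> state \<Rightarrow> state \<Rightarrow> real set \<Rightarrow> bool" where
  "R_wave \<gamma> U j V W S \<longleftrightarrow>
    V = W \<and> S = {} \<or>
    rarefaction \<gamma> U j V W \<and> S = {eigval \<gamma> j V..eigval \<gamma> j W}"

definition W_wave :: "real \<Rightarrow> (real \<Rightarrow> state) \<Rightarrow> nat \<Rightarrow> state \<Rightarrow> state \<Rightarrow> real set \<Rightarrow> bool" where
  "W_wave \<gamma> U j V W S \<longleftrightarrow>
    R_wave \<gamma> U j V W S \<or> (\<exists>\<sigma>. lax_shock \<gamma> j \<sigma> V W \<and> S = {\<sigma>})"

definition C_wave :: "real \<Rightarrow> state \<Rightarrow> state \<Rightarrow> real set \<Rightarrow> bool" where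
  "C_wave \<gamma> V W S \<longleftrightarrow>
    V = W \<and> S = {} \<or>
    V \<noteq> W \<and> velocity V = velocity W \<and> pressure \<gamma> V = pressure \<gamma> W \<and> S = {velocity V}"

text \<open>
  A self-similar function \<open>U (x / t)\<close> is represented by its profile \<open>U\<close>. The list \<open>Vs\<close> holds the
  constant states and \<open>Ss\<close> the speed sets of the waves between them, from left to right:
  away from the waves, \<open>U\<close> takes the value \<open>Vs ! i\<close> to the right of the first \<open>i\<close> waves and to the
  left of the others. Values at the speeds of discontinuities are irrelevant.
  A stationary wave contributes the speed set \<open>{0}\<close>, so that the ordering makes the waves
  listed before it have nonpositive speeds and those listed after it nonnegative speeds.
\<close>

definition separated_states ::
  "real \<Rightarrow> (real \<Rightarrow> state) \<Rightarrow> state list \<Rightarrow> real set list \<Rightarrow> bool" where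
  "separated_states \<gamma> U Vs Ss \<longleftrightarrow>
    length Vs = Suc (length Ss) \<and>
    (\<forall>V\<in>set Vs. gas_state \<gamma> V) \<and>
    sorted_wrt (\<lambda>S T. \<forall>s\<in>S. \<forall>t\<in>T. s \<le> t) Ss \<and>
    (\<forall>i<length Vs. \<forall>\<xi>.
      (\<forall>s\<in>\<Union>(set (take i Ss)). s < \<xi>) \<and> (\<forall>s\<in>\<Union>(set (drop i Ss)). \<xi> < s) \<longrightarrow> U \<xi> = Vs ! i)"

definition riemann_solution ::
  "real \<Rightarrow> real \<Rightarrow> real \<Rightarrow> real \<Rightarrow> (real \<Rightarrow> state) \<Rightarrow> state \<Rightarrow> state \<Rightarrow> state \<Rightarrow> state \<Rightarrow> bool" where
  "riemann_solution \<gamma> k1 k2 k3 U UL UR Um Up \<longleftrightarrow>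
    (\<exists>U1 U2 U3 U4 S1 S2 S3 T1 T2 T3.
      W_wave \<gamma> U 1 UL U1 S1 \<and> C_wave \<gamma> U1 U2 S2 \<and> W_wave \<gamma> U 3 U2 Um S3 \<and>
      (\<forall>s\<in>S1 \<union> S2 \<union> S3. s \<le> 0) \<and>
      stationary_wave \<gamma> k1 k2 k3 Um Up \<and>
      W_wave \<gamma> U 1 Up U3 T1 \<and> C_wave \<gamma> U3 U4 T2 \<and> W_wave \<gamma> U 3 U4 UR T3 \<and>
      (\<forall>s\<in>T1 \<union> T2 \<union> T3. s \<ge> 0) \<and>
      separated_states \<gamma> U [UL, U1, U2, Um, Up, U3, U4, UR] [S1, S2, S3, {0}, T1, T2, T3])"

definition type1 ::
  "real \<Rightarrow> real \<Rightarrow> real \<Rightarrow> real \<Rightarrow> (real \<Rightarrow> state) \<Rightarrow> state \<Rightarrow> state \<Rightarrow> state \<Rightarrow> state \<Rightarrow> bool" where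
  "type1 \<gamma> k1 k2 k3 U UL UR Um Up \<longleftrightarrow> \<not> choked \<gamma> Um Up \<and>
    (\<exists>U4 S1 T2 T3.
      W_wave \<gamma> U 1 UL Um S1 \<and> stationary_wave \<gamma> k1 k2 k3 Um Up \<and>
      C_wave \<gamma> Up U4 T2 \<and> W_wave \<gamma> U 3 U4 UR T3 \<and>
      separated_states \<gamma> U [UL, Um, Up, U4, UR] [S1, {0}, T2, T3])"

definition type2 ::
  "real \<Rightarrow> real \<Rightarrow> real \<Rightarrow> real \<Rightarrow> (real \<Rightarrow> state) \<Rightarrow> state \<Rightarrow> state \<Rightarrow> state \<Rightarrow> state \<Rightarrow> bool" where
  "type2 \<gamma> k1 k2 k3 U UL UR Um Up \<longleftrightarrow> \<not> choked \<gamma> Um Up \<and> Um = UL \<and>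
    (\<exists>U3 U4 T1 T2 T3.
      stationary_wave \<gamma> k1 k2 k3 UL Up \<and>
      W_wave \<gamma> U 1 Up U3 T1 \<and> C_wave \<gamma> U3 U4 T2 \<and> W_wave \<gamma> U 3 U4 UR T3 \<and>
      separated_states \<gamma> U [UL, Up, U3, U4, UR] [{0}, T1, T2, T3])"

definition type3 ::
  "real \<Rightarrow> real \<Rightarrow> real \<Rightarrow> real \<Rightarrow> (real \<Rightarrow> state) \<Rightarrow> state \<Rightarrow> state \<Rightarrow> state \<Rightarrow> state \<Rightarrow> bool" where
  "type3 \<gamma> k1 k2 k3 U UL UR Um Up \<longleftrightarrow> choked \<gamma> Um Up \<and> mach \<gamma> Up = 1 \<and>
    (\<exists>U3 U4 S1 T1 T2 T3.
      W_wave \<gamma> U 1 UL Um S1 \<and> stationary_wave \<gamma> k1 k2 k3 Um Up \<and>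
      R_wave \<gamma> U 1 Up U3 T1 \<and> C_wave \<gamma> U3 U4 T2 \<and> W_wave \<gamma> U 3 U4 UR T3 \<and>
      separated_states \<gamma> U [UL, Um, Up, U3, U4, UR] [S1, {0}, T1, T2, T3])"

definition type4 ::
  "real \<Rightarrow> real \<Rightarrow> real \<Rightarrow> real \<Rightarrow> (real \<Rightarrow> state) \<Rightarrow> state \<Rightarrow> state \<Rightarrow> state \<Rightarrow> state \<Rightarrow> bool" where
  "type4 \<gamma> k1 k2 k3 U UL UR Um Up \<longleftrightarrow> choked \<gamma> Um Up \<and> mach \<gamma> Up = 1 \<and> Um = UL \<and>
    (\<exists>U3 U4 T1 T2 T3.
      stationary_wave \<gamma> k1 k2 k3 UL Up \<and>
      R_wave \<gamma> U 1 Up U3 T1 \<and> C_wave \<gamma> U3 U4 T2 \<and> W_wave \<gamma> U 3 U4 UR T3 \<and>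
      separated_states \<gamma> U [UL, Up, U3, U4, UR] [{0}, T1, T2, T3])"

definition type5 ::
  "real \<Rightarrow> real \<Rightarrow> real \<Rightarrow> real \<Rightarrow> (real \<Rightarrow> state) \<Rightarrow> state \<Rightarrow> state \<Rightarrow> state \<Rightarrow> state \<Rightarrow> bool" where
  "type5 \<gamma> k1 k2 k3 U UL UR Um Up \<longleftrightarrow> choked \<gamma> Um Up \<and> mach \<gamma> Um = 1 \<and>
    (\<exists>U3 U4 S1 T1 T2 T3.
      R_wave \<gamma> U 1 UL Um S1 \<and> stationary_wave \<gamma> k1 k2 k3 Um Up \<and>
      W_wave \<gamma> U 1 Up U3 T1 \<and> C_wave \<gamma> U3 U4 T2 \<and> W_wave \<gamma> U 3 U4 UR T3 \<and>
      separated_states \<gamma> U [UL, Um, Up, U3, U4, UR] [S1, {0}, T1, T2, T3])"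

definition type6 ::
  "real \<Rightarrow> real \<Rightarrow> real \<Rightarrow> real \<Rightarrow> (real \<Rightarrow> state) \<Rightarrow> state \<Rightarrow> state \<Rightarrow> state \<Rightarrow> state \<Rightarrow> bool" where
  "type6 \<gamma> k1 k2 k3 U UL UR Um Up \<longleftrightarrow> choked \<gamma> Um Up \<and> mach \<gamma> Um = 1 \<and>
    (\<exists>U4 S1 T2 T3.
      R_wave \<gamma> U 1 UL Um S1 \<and> stationary_wave \<gamma> k1 k2 k3 Um Up \<and>
      C_wave \<gamma> Up U4 T2 \<and> W_wave \<gamma> U 3 U4 UR T3 \<and>
      separated_states \<gamma> U [UL, Um, Up, U4, UR] [S1, {0}, T2, T3])"

definition type7 ::
  "real \<Rightarrow> real \<Rightarrow> real \<Rightarrow> real \<Rightarrow> (real \<Rightarrow> state) \<Rightarrow> state \<Rightarrow> state \<Rightarrow> state \<Rightarrow> state \<Rightarrow> bool" where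
  "type7 \<gamma> k1 k2 k3 U UL UR Um Up \<longleftrightarrow> choked \<gamma> Um Up \<and> mach \<gamma> Um = 1 \<and> mach \<gamma> Up = 1 \<and>
    (\<exists>U3 U4 S1 T1 T2 T3.
      R_wave \<gamma> U 1 UL Um S1 \<and> stationary_wave \<gamma> k1 k2 k3 Um Up \<and>
      R_wave \<gamma> U 1 Up U3 T1 \<and> C_wave \<gamma> U3 U4 T2 \<and> W_wave \<gamma> U 3 U4 UR T3 \<and>
      separated_states \<gamma> U [UL, Um, Up, U3, U4, UR] [S1, {0}, T1, T2, T3])"

end

theory Submission imports Defs begin

text \<open>
  Because \<open>u\<^sub>- > 0\<close>, neither a contact nor a 3-wave can reach \<open>U\<^sub>-\<close> with nonpositive speed, so
  only a 1-wave survives on the left; a nontrivial one needs \<open>\<lambda>\<^sub>1(U\<^sub>-) \<le> 0\<close>, and equality excludes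
  shocks. Symmetrically, a nontrivial 1-wave leaving \<open>U\<^sub>+\<close> needs \<open>\<lambda>\<^sub>1(U\<^sub>+) \<ge> 0\<close>, with equality only
  for rarefactions. Writing \<open>q\<close>, \<open>n\<close>, \<open>e\<close> for the three flux components, the identity
  \<open>\<gamma>\<^sup>2 n\<^sup>2 - 2 (\<gamma>\<^sup>2 - 1) q e = (\<rho> u\<^sup>2 - \<gamma> p)\<^sup>2\<close> shows that \<open>q e / n\<^sup>2\<close> is maximal exactly at sonic
  states. The stationary wave multiplies this quotient by \<open>1 + k\<close>, so the sign of \<open>k\<close> decides which
  side of a choked wave is sonic.
\<close>

section \<open>Sonic states and the flux components\<close>

text \<open>Up to the factor \<open>(\<gamma> - 1)^2\<close>, this is the discriminant of the
  quadratic equation for \<open>u\<close> left after eliminating \<rho> and \<open>p\<close> from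
  the three flux components; a double root is a sonic state.\<close>

definition sonic_defect :: "real \<Rightarrow> state \<Rightarrow> real" where
  "sonic_defect \<gamma> V = (density V * (velocity V)\<^sup>2 - \<gamma> * pressure \<gamma> V)\<^sup>2"

lemma energy_plus_pressure:
  "2 * (\<gamma> - 1) * (energy V + pressure \<gamma> V)
    = 2 * \<gamma> * pressure \<gamma> V + (\<gamma> - 1) * (density V * (velocity V)\<^sup>2)"
  unfolding pressure_def by (simp add: field_simps)

text \<open>Both terms on the left are quadratic forms in \<open>x = \<rho> u^2\<close> and
  \<open>p\<close>, because \<open>2 (\<gamma> - 1) (E + p)\<close> is linear in them.\<close>

lemma flux_identity:
  "\<gamma>\<^sup>2 * (density V * (velocity V)\<^sup>2 + pressure \<gamma> V)\<^sup>2
      - 2 * (\<gamma>\<^sup>2 - 1) * ((density V * velocity V) * ((energy V + pressure \<gamma> V) * velocity V))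
    = sonic_defect \<gamma> V"
proof -
  define x where "x = density V * (velocity V)\<^sup>2"
  define p where "p = pressure \<gamma> V"
  have "2 * (\<gamma>\<^sup>2 - 1) * ((density V * velocity V) * ((energy V + p) * velocity V))
      = (\<gamma> + 1) * x * (2 * (\<gamma> - 1) * (energy V + p))"
    by (simp add: x_def power2_eq_square algebra_simps)
  also have "\<dots> = (\<gamma> + 1) * x * (2 * \<gamma> * p + (\<gamma> - 1) * x)"
    using energy_plus_pressure[of \<gamma> V] by (simp add: x_def p_def)
  finally have "\<gamma>\<^sup>2 * (x + p)\<^sup>2
      - 2 * (\<gamma>\<^sup>2 - 1) * ((density V * velocity V) * ((energy V + p) * velocity V)) = (x - \<gamma> * p)\<^sup>2"
    by (simp add: power2_eq_square algebra_simps)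
  then show ?thesis
    by (simp add: sonic_defect_def x_def p_def)
qed

lemma sound_speed_pos:
  assumes "\<gamma> > 1" "gas_state \<gamma> V"
  shows "sound_speed \<gamma> V > 0"
  using assms by (simp add: gas_state_def sound_speed_def)

lemma mach_eq_1_iff:
  assumes "\<gamma> > 1" "gas_state \<gamma> V"
  shows "mach \<gamma> V = 1 \<longleftrightarrow> eigval \<gamma> 1 V = 0"
  using sound_speed_pos[OF assms] by (auto simp: mach_def eigval_def)

text \<open>Velocity and sound speed are both positive, so \<open>u = a\<close> may be squared and
  multiplied by \<rho>.\<close>

lemma eigval_1_eq_0_iff:
  assumes "\<gamma> > 1" "gas_state \<gamma> V" "velocity V > 0"
  shows "eigval \<gamma> 1 V = 0 \<longleftrightarrow> sonic_defect \<gamma> V = 0"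
proof -
  have d: "density V > 0" and p: "pressure \<gamma> V > 0"
    using assms by (auto simp: gas_state_def)
  have "eigval \<gamma> 1 V = 0 \<longleftrightarrow> (velocity V)\<^sup>2 = (sound_speed \<gamma> V)\<^sup>2"
    using assms(3) sound_speed_pos[OF assms(1,2)] by (auto simp: eigval_def power2_eq_iff)
  also have "\<dots> \<longleftrightarrow> (velocity V)\<^sup>2 = \<gamma> * pressure \<gamma> V / density V"
    using assms(1) d p by (simp add: sound_speed_def)
  also have "\<dots> \<longleftrightarrow> sonic_defect \<gamma> V = 0"
    using d by (auto simp: sonic_defect_def field_simps)
  finally show ?thesis .
qed

text \<open>The jump multiplies \<open>n^2\<close> by \<open>(1 + k2)^2\<close> and
  \<open>q e\<close> by \<open>(1 + k2)^2 (1 + k)\<close>; the common factor comes out and the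
  surplus \<open>k\<close> remains. Later only the sign of \<open>c\<close> matters.\<close>

lemma stationary_wave_sonic_defect:
  assumes "\<gamma> > 1" "k2 > -1"
    and k: "k = (1 + k1) * (1 + k3) / (1 + k2)\<^sup>2 - 1"
    and sw: "stationary_wave \<gamma> k1 k2 k3 V W"
    and V: "gas_state \<gamma> V" "velocity V > 0"
  obtains c where "c > 0" "sonic_defect \<gamma> W = (1 + k2)\<^sup>2 * (sonic_defect \<gamma> V - k * c)"
proof
  define q where "q = (\<lambda>V. density V * velocity V)"
  define n where "n = (\<lambda>V. density V * (velocity V)\<^sup>2 + pressure \<gamma> V)"
  define e where "e = (\<lambda>V. (energy V + pressure \<gamma> V) * velocity V)"
  define c where "c = 2 * (\<gamma>\<^sup>2 - 1) * (q V * e V)"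
  have d: "density V > 0" and p: "pressure \<gamma> V > 0"
    using V by (auto simp: gas_state_def)
  \<comment> \<open>Positivity of \<open>E + p\<close> makes \<open>e V\<close>, and hence
    \<open>c\<close>, positive.\<close>
  have "0 < 2 * \<gamma> * pressure \<gamma> V + (\<gamma> - 1) * (density V * (velocity V)\<^sup>2)"
    using assms(1) d p by (simp add: add_pos_nonneg)
  then have "energy V + pressure \<gamma> V > 0"
    using energy_plus_pressure[of \<gamma> V] assms(1)
    by (metis diff_gt_0_iff_gt mult_pos_pos zero_less_mult_pos zero_less_numeral)
  moreover have "\<gamma>\<^sup>2 > 1"
    using assms(1) by (simp add: one_less_power)
  ultimately show "c > 0"
    using d V by (simp add: c_def q_def e_def)
  have defect: "sonic_defect \<gamma> X = \<gamma>\<^sup>2 * (n X)\<^sup>2 - 2 * (\<gamma>\<^sup>2 - 1) * (q X * e X)" for X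
    using flux_identity[of \<gamma> X] by (simp add: q_def n_def e_def)
  have jump: "q W = q V * (1 + k1)" "n W = n V * (1 + k2)" "e W = e V * (1 + k3)"
    using sw by (simp_all add: stationary_wave_def q_def n_def e_def)
  have "(1 + k1) * (1 + k3) = (1 + k2)\<^sup>2 * (1 + k)"
    using assms(2) by (simp add: k)
  then have qe: "q W * e W = (1 + k2)\<^sup>2 * (1 + k) * (q V * e V)"
    unfolding jump by (simp add: ac_simps)
  show "sonic_defect \<gamma> W = (1 + k2)\<^sup>2 * (sonic_defect \<gamma> V - k * c)"
    unfolding defect qe jump(2) c_def power_mult_distrib by (simp only: algebra_simps)
qed

text \<open>Both defects are squares. In their relation, \<open>k > 0\<close> forces a positive
  defect at \<open>V\<close>, \<open>k < 0\<close> forces one at \<open>W\<close>, and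
  \<open>k = 0\<close> makes the two proportional.\<close>

lemma stationary_wave_sonic_side:
  assumes "\<gamma> > 1" "k2 > -1"
    and "k = (1 + k1) * (1 + k3) / (1 + k2)\<^sup>2 - 1"
    and "stationary_wave \<gamma> k1 k2 k3 V W"
    and V: "gas_state \<gamma> V" "velocity V > 0"
    and W: "gas_state \<gamma> W" "velocity W > 0"
  shows "k > 0 \<Longrightarrow> eigval \<gamma> 1 V \<noteq> 0"
    and "k < 0 \<Longrightarrow> eigval \<gamma> 1 W \<noteq> 0"
    and "k = 0 \<Longrightarrow> eigval \<gamma> 1 V = 0 \<longleftrightarrow> eigval \<gamma> 1 W = 0"
proof -
  obtain c where c: "c > 0" "sonic_defect \<gamma> W = (1 + k2)\<^sup>2 * (sonic_defect \<gamma> V - k * c)"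
    using stationary_wave_sonic_defect[OF assms(1-6)] .
  have k2: "(1 + k2)\<^sup>2 > 0"
    using assms(2) by simp
  have nonneg: "sonic_defect \<gamma> X \<ge> 0" for X
    by (simp add: sonic_defect_def)
  note iff = eigval_1_eq_0_iff[OF assms(1) V] eigval_1_eq_0_iff[OF assms(1) W]
  have le: "k * c \<le> sonic_defect \<gamma> V"
    using nonneg[of W] k2 c(2) by (simp add: zero_le_mult_iff)
  show "eigval \<gamma> 1 V \<noteq> 0" if "k > 0"
    using mult_pos_pos[OF that c(1)] le iff by simp
  show "eigval \<gamma> 1 W \<noteq> 0" if "k < 0"
    using mult_neg_pos[OF that c(1)] nonneg[of V] c(2) k2 iff by simp
  show "eigval \<gamma> 1 V = 0 \<longleftrightarrow> eigval \<gamma> 1 W = 0" if "k = 0"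
    using that c(2) k2 iff by simp
qed

lemma choked_iff:
  assumes "\<gamma> > 1" "gas_state \<gamma> V" "velocity V > 0" "gas_state \<gamma> W" "velocity W > 0"
  shows "choked \<gamma> V W \<longleftrightarrow> eigval \<gamma> 1 V = 0 \<or> eigval \<gamma> 1 W = 0"
  using assms(3,5) sound_speed_pos[OF assms(1,2)] sound_speed_pos[OF assms(1,4)]
  by (auto simp: choked_def eigval_def)

section \<open>Waves compatible with the sign of their speeds\<close>

text \<open>Sign arguments need just one occupied speed to compare with an end eigenvalue: a fan
  contains both eigenvalues, a shock speed lies strictly between them.\<close>

lemma W_wave_cases [consumes 1, case_names trivial rarefaction shock]:
  assumes "W_wave \<gamma> U j V W S"
  obtains "V = W" "S = {}"
  | "R_wave \<gamma> U j V W S" "eigval \<gamma> j V \<in> S" "eigval \<gamma> j W \<in> S"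
  | \<sigma> where "\<sigma> \<in> S" "eigval \<gamma> j V > \<sigma>" "\<sigma> > eigval \<gamma> j W"
proof -
  consider "V = W" "S = {}"
    | "rarefaction \<gamma> U j V W" "S = {eigval \<gamma> j V..eigval \<gamma> j W}"
    | \<sigma> where "lax_shock \<gamma> j \<sigma> V W" "S = {\<sigma>}"
    using assms unfolding W_wave_def R_wave_def by blast
  then show thesis
  proof cases
    case 1
    then show thesis
      by (rule that(1))
  next
    case 2
    then show thesis
      by (intro that(2)) (auto simp: R_wave_def rarefaction_def)
  next
    case 3
    then show thesis
      by (intro that(3)[of \<sigma>]) (auto simp: lax_shock_def)
  qed
qed

lemma W_wave_3_trivial_left:
  assumes "W_wave \<gamma> U 3 V W S" "\<forall>s\<in>S. s \<le> 0" "eigval \<gamma> 3 W > 0"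
  shows "V = W \<and> S = {}"
  using assms by (cases rule: W_wave_cases) force+

lemma C_wave_trivial_left:
  assumes "C_wave \<gamma> V W S" "\<forall>s\<in>S. s \<le> 0" "velocity W > 0"
  shows "V = W \<and> S = {}"
  using assms by (auto simp: C_wave_def)

text \<open>A nontrivial wave occupies a speed at least \<open>eigval \<gamma> 1 W\<close>, and a
  shock a strictly larger one.\<close>

lemma W_wave_1_left:
  assumes "W_wave \<gamma> U 1 V W S" "\<forall>s\<in>S. s \<le> 0"
  shows "eigval \<gamma> 1 W > 0 \<Longrightarrow> V = W \<and> S = {}"
    and "eigval \<gamma> 1 W = 0 \<Longrightarrow> R_wave \<gamma> U 1 V W S"
  using assms by (atomize (full), cases rule: W_wave_cases) (force simp: R_wave_def)+

text \<open>Mirror image: a shock speed lies strictly below \<open>eigval \<gamma> 1 V\<close>, and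
  a fan starts at that value.\<close>

lemma W_wave_1_right:
  assumes "W_wave \<gamma> U 1 V W S" "\<forall>s\<in>S. s \<ge> 0"
  shows "eigval \<gamma> 1 V < 0 \<Longrightarrow> V = W \<and> S = {}"
    and "eigval \<gamma> 1 V = 0 \<Longrightarrow> R_wave \<gamma> U 1 V W S"
  using assms by (atomize (full), cases rule: W_wave_cases) (force simp: R_wave_def)+

text \<open>An empty speed set puts no constraint on \<xi>, so only the indices of the states behind
  it change.\<close>

lemma separated_states_remove_trivial:
  assumes sep: "separated_states \<gamma> U (As @ V # V # Bs) (Ss @ {} # Ts)"
    and len: "length As = length Ss"
  shows "separated_states \<gamma> U (As @ V # Bs) (Ss @ Ts)"
  unfolding separated_states_def
proof (intro conjI allI impI)
  show "length (As @ V # Bs) = Suc (length (Ss @ Ts))"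
    "\<forall>V\<in>set (As @ V # Bs). gas_state \<gamma> V"
    "sorted_wrt (\<lambda>S T. \<forall>s\<in>S. \<forall>t\<in>T. s \<le> t) (Ss @ Ts)"
    using sep by (auto simp: separated_states_def sorted_wrt_append)
next
  fix i \<xi>
  assume i: "i < length (As @ V # Bs)"
    and \<xi>: "(\<forall>s\<in>\<Union>(set (take i (Ss @ Ts))). s < \<xi>) \<and> (\<forall>s\<in>\<Union>(set (drop i (Ss @ Ts))). \<xi> < s)"
  have U: "U \<xi> = (As @ V # V # Bs) ! j"
    if "j < length (As @ V # V # Bs)"
      "\<forall>s\<in>\<Union>(set (take j (Ss @ {} # Ts))). s < \<xi>"
      "\<forall>s\<in>\<Union>(set (drop j (Ss @ {} # Ts))). \<xi> < s" for j
    using sep that unfolding separated_states_def by blast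
  show "U \<xi> = (As @ V # Bs) ! i"
  proof (cases "i \<le> length Ss")
    \<comment> \<open>Here the index is unchanged; \<open>i = length Ss\<close> picks the first copy
      of \<open>V\<close>.\<close>
    case True
    then have "U \<xi> = (As @ V # V # Bs) ! i"
      using i \<xi> by (intro U) auto
    with True len show ?thesis
      by (cases "i = length Ss") (auto simp: nth_append)
  next
    case False
    \<comment> \<open>Behind the deleted wave the index shifts by one; this form lets
      \<open>take\<close> and \<open>drop\<close> step over the empty set.\<close>
    then have "Suc i - length Ss = Suc (i - length Ss)"
      by simp
    then have "U \<xi> = (As @ V # V # Bs) ! Suc i"
      using i \<xi> False by (intro U) auto
    with False len show ?thesis
      by (auto simp: nth_append nth_Cons' Suc_diff_le)
  qed
qed

section \<open>Classification of the structures\<close>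

theorem corollary3p1:
  fixes \<gamma> k1 k2 k3 k :: real
    and U :: "real \<Rightarrow> state"
    and UL UR Um Up :: state
  assumes "\<gamma> > 1" and "k1 > -1" and "k2 > -1" and "k3 > -1"
    and "k = (1 + k1) * (1 + k3) / (1 + k2)\<^sup>2 - 1"
    and "riemann_solution \<gamma> k1 k2 k3 U UL UR Um Up"
    and "velocity Um > 0" and "velocity Up > 0"
    and "monotonicity_criterion \<gamma> Um Up"
  shows "(k > 0 \<longrightarrow>
           type1 \<gamma> k1 k2 k3 U UL UR Um Up \<or> type2 \<gamma> k1 k2 k3 U UL UR Um Up \<or>
           type3 \<gamma> k1 k2 k3 U UL UR Um Up \<or> type4 \<gamma> k1 k2 k3 U UL UR Um Up) \<and>
         (k < 0 \<longrightarrow>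
           type1 \<gamma> k1 k2 k3 U UL UR Um Up \<or> type2 \<gamma> k1 k2 k3 U UL UR Um Up \<or>
           type5 \<gamma> k1 k2 k3 U UL UR Um Up \<or> type6 \<gamma> k1 k2 k3 U UL UR Um Up) \<and>
         (k = 0 \<longrightarrow>
           type1 \<gamma> k1 k2 k3 U UL UR Um Up \<or> type2 \<gamma> k1 k2 k3 U UL UR Um Up \<or>
           type7 \<gamma> k1 k2 k3 U UL UR Um Up)"
proof -
  obtain U1 U2 U3 U4 S1 S2 S3 T1 T2 T3 where
    W1: "W_wave \<gamma> U 1 UL U1 S1" and C2: "C_wave \<gamma> U1 U2 S2" and W3: "W_wave \<gamma> U 3 U2 Um S3"
    and neg: "\<forall>s\<in>S1 \<union> S2 \<union> S3. s \<le> 0"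
    and sw: "stationary_wave \<gamma> k1 k2 k3 Um Up"
    and Wr: "W_wave \<gamma> U 1 Up U3 T1" and Cr: "C_wave \<gamma> U3 U4 T2" and W3r: "W_wave \<gamma> U 3 U4 UR T3"
    and nonneg: "\<forall>s\<in>T1 \<union> T2 \<union> T3. s \<ge> 0"
    and sep: "separated_states \<gamma> U [UL, U1, U2, Um, Up, U3, U4, UR] [S1, S2, S3, {0}, T1, T2, T3]"
    using assms(6) unfolding riemann_solution_def by blast
  have gas: "gas_state \<gamma> Um" "gas_state \<gamma> Up"
    using sep by (auto simp: separated_states_def)
  \<comment> \<open>The left waves are removed from right to left: once the 3-wave is gone, the
    contact ends at \<open>Um\<close>.\<close>
  have "eigval \<gamma> 3 Um > 0"
    using assms(7) sound_speed_pos[OF assms(1) gas(1)] by (simp add: eigval_def)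
  then have e3: "U2 = Um" "S3 = {}"
    using W_wave_3_trivial_left[OF W3] neg by auto
  then have e2: "U1 = Um" "S2 = {}"
    using C_wave_trivial_left[OF C2] neg assms(7) by auto
  have Wl: "W_wave \<gamma> U 1 UL Um S1"
    using W1 e2 by simp
  have "separated_states \<gamma> U [UL, Um, Um, Up, U3, U4, UR] [S1, {}, {0}, T1, T2, T3]"
    using separated_states_remove_trivial[of \<gamma> U "[UL]" Um "[Um, Up, U3, U4, UR]" "[S1]"] sep e2 e3
    by simp
  then have sep6: "separated_states \<gamma> U [UL, Um, Up, U3, U4, UR] [S1, {0}, T1, T2, T3]"
    using separated_states_remove_trivial[of \<gamma> U "[UL]" Um "[Up, U3, U4, UR]" "[S1]"] by simp
  have left: "eigval \<gamma> 1 Um > 0 \<Longrightarrow> UL = Um \<and> S1 = {}"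
    "eigval \<gamma> 1 Um = 0 \<Longrightarrow> R_wave \<gamma> U 1 UL Um S1"
    using W_wave_1_left[OF Wl] neg by auto
  have right: "eigval \<gamma> 1 Up < 0 \<Longrightarrow> Up = U3 \<and> T1 = {}"
    "eigval \<gamma> 1 Up = 0 \<Longrightarrow> R_wave \<gamma> U 1 Up U3 T1"
    using W_wave_1_right[OF Wr] nonneg by auto
  note choked = choked_iff[OF assms(1) gas(1) assms(7) gas(2) assms(8)]
  note mach = mach_eq_1_iff[OF assms(1) gas(1)] mach_eq_1_iff[OF assms(1) gas(2)]
  note side = stationary_wave_sonic_side[OF assms(1,3,5) sw gas(1) assms(7) gas(2) assms(8)]
  show ?thesis
  proof (cases "choked \<gamma> Um Up")
    case False
    have "eigval \<gamma> 1 Um * eigval \<gamma> 1 Up \<ge> 0"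
      using assms(9) by (simp add: monotonicity_criterion_def)
    \<comment> \<open>Both eigenvalues are nonzero with equal signs: supersonic flow removes the
      left wave, subsonic flow the right 1-wave.\<close>
    then consider "eigval \<gamma> 1 Um > 0" | "eigval \<gamma> 1 Up < 0"
      using False choked by (auto simp: zero_le_mult_iff)
    then have "type1 \<gamma> k1 k2 k3 U UL UR Um Up \<or> type2 \<gamma> k1 k2 k3 U UL UR Um Up"
    proof cases
      case 1
      then have e: "UL = Um" "S1 = {}"
        using left by auto
      have "separated_states \<gamma> U [UL, Up, U3, U4, UR] [{0}, T1, T2, T3]"
        using separated_states_remove_trivial[of \<gamma> U "[]" Um "[Up, U3, U4, UR]" "[]"] sep6 e by simp
      then have "type2 \<gamma> k1 k2 k3 U UL UR Um Up"
        unfolding type2_def using False sw Wr Cr W3r e by blast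
      then show ?thesis ..
    next
      case 2
      then have e: "U3 = Up" "T1 = {}"
        using right by auto
      have "separated_states \<gamma> U [UL, Um, Up, U4, UR] [S1, {0}, T2, T3]"
        using separated_states_remove_trivial[of \<gamma> U "[UL, Um]" Up "[U4, UR]" "[S1, {0}]"] sep6 e
        by simp
      then have "type1 \<gamma> k1 k2 k3 U UL UR Um Up"
        unfolding type1_def using False sw Wl Cr W3r e by blast
      then show ?thesis ..
    qed
    then show ?thesis
      by blast
  next
    case True
    \<comment> \<open>Type 4 is the instance of Type 3 with trivial left wave.\<close>
    have "type3 \<gamma> k1 k2 k3 U UL UR Um Up" if "k > 0"
    proof -
      have "eigval \<gamma> 1 Up = 0"
        using True choked side(1)[OF that] by blast
      then show ?thesis
        unfolding type3_def using True mach right(2) Wl sw Cr W3r sep6 by blast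
    qed
    \<comment> \<open>Type 6 is the instance of Type 5 with trivial 1-wave on the right.\<close>
    moreover have "type5 \<gamma> k1 k2 k3 U UL UR Um Up" if "k < 0"
    proof -
      have "eigval \<gamma> 1 Um = 0"
        using True choked side(2)[OF that] by blast
      then show ?thesis
        unfolding type5_def using True mach left(2) Wr sw Cr W3r sep6 by blast
    qed
    moreover have "type7 \<gamma> k1 k2 k3 U UL UR Um Up" if "k = 0"
    proof -
      have "eigval \<gamma> 1 Um = 0" "eigval \<gamma> 1 Up = 0"
        using True choked side(3)[OF that] by blast+
      then show ?thesis
        unfolding type7_def using True mach left(2) right(2) sw Cr W3r sep6 by blast
    qed
    ultimately show ?thesis
      by blast
  qed
qed

end
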